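(* Let $q\ge 0$, let $\Omega\subseteq\mathbf{R}$ be an interval or union of intervals and $w\ge 0$ a suitable weight function on $\Omega$. Let $\{u_i\}_{i=0}^q$ be an orthonormal basis of $\mathcal{P}_q$ consisting of eigenfunctions of the operator $\chi$, $\chi u_i=\Lambda_iu_i$. Let $f$ be a polynomial of degree at most $2q+1$. Then $$\int_\Omega w(x)f(x)\,dx=\sum_{i=0}^q\langle 1|u_i\rangle^2f(\Lambda_i),$$ i.e. the quadrature rule $\int_\Omega w(x)f(x)\,dx\approx\sum_{i=0}^q\langle 1|u_i\rangle^2f(\Lambda_i)$ is exact for all polynomials of degree at most $2q+1$.
   Context: "Suitable" weight: $\Omega$ and $w:\Omega\to[0,\infty)$ are measurable, $\int_\Omega w(x)|p(x)|\,dx<\infty$ for every polynomial $p$, and $\int_\Omega w(x)p(x)^2\,dx>0$ for every nonzero polynomial $p$. $\mathcal{P}_m$ is the real vector space of one-variable polynomials of degree at most $m$, with inner product $\langle a|b\rangle=\int_\Omega w(x)a(x)b(x)\,dx$. $\Pi_q:\mathcal{P}_{q+1}\to\mathcal{P}_q$ is the orthogonal projection with respect to this inner product, and $\chi:\mathcal{P}_q\to\mathcal{P}_q$ is the self-adjoint operator $\chi p=\Pi_q(xp)$. *)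

theory Defs
  imports "HOL-Analysis.Analysis" "HOL-Computational_Algebra.Polynomial"
begin

text \<open>
  Throughout, measurability and integration are with respect to Lebesgue measure on the real line.
  The values of a weight \<^term>\<open>w\<close> outside \<^term>\<open>\<Omega>\<close> are irrelevant.
\<close>

definition suitable_weight :: "real set \<Rightarrow> (real \<Rightarrow> real) \<Rightarrow> bool" where
  "suitable_weight \<Omega> w \<longleftrightarrow>
     \<Omega> \<in> sets lebesgue \<and>
     w \<in> borel_measurable (lebesgue_on \<Omega>) \<and>
     (\<forall>x\<in>\<Omega>. 0 \<le> w x) \<and>
     (\<forall>p :: real poly. integrable (lebesgue_on \<Omega>) (\<lambda>x. w x * \<bar>poly p x\<bar>)) \<and>
     (\<forall>p :: real poly. p \<noteq> 0 \<longrightarrow> 0 < (LINT x|lebesgue_on \<Omega>. w x * (poly p x)\<^sup>2))"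

definition polys_upto :: "nat \<Rightarrow> real poly set" where
  "polys_upto m = {p. degree p \<le> m}"

definition weighted_inner ::
    "real set \<Rightarrow> (real \<Rightarrow> real) \<Rightarrow> real poly \<Rightarrow> real poly \<Rightarrow> real" where
  "weighted_inner \<Omega> w a b = (LINT x|lebesgue_on \<Omega>. w x * poly a x * poly b x)"

text \<open>
  For a suitable weight the inner product is positive definite, so every polynomial has exactly
  one orthogonal projection onto the finite-dimensional space \<^term>\<open>polys_upto q\<close>. The intended
  domain is \<^term>\<open>polys_upto (q + 1)\<close>.
\<close>

definition proj_upto ::
    "real set \<Rightarrow> (real \<Rightarrow> real) \<Rightarrow> nat \<Rightarrow> real poly \<Rightarrow> real poly" where
  "proj_upto \<Omega> w q p =
     (THE r. r \<in> polys_upto q \<and> (\<forall>s\<in>polys_upto q. weighted_inner \<Omega> w (p - r) s = 0))"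

text \<open>The polynomial \<^term>\<open>[:0, 1:]\<close> is the indeterminate.\<close>

definition position_op ::
    "real set \<Rightarrow> (real \<Rightarrow> real) \<Rightarrow> nat \<Rightarrow> real poly \<Rightarrow> real poly" where
  "position_op \<Omega> w q p = proj_upto \<Omega> w q ([:0, 1:] * p)"

text \<open>
  The type \<^typ>\<open>real poly\<close> carries no scalar multiplication of class \<^class>\<open>real_vector\<close>,
  so span and linear dependence are those of the module structure given by \<^const>\<open>smult\<close>.
\<close>

definition orthonormal_basis_upto ::
    "real set \<Rightarrow> (real \<Rightarrow> real) \<Rightarrow> nat \<Rightarrow> (nat \<Rightarrow> real poly) \<Rightarrow> bool" where
  "orthonormal_basis_upto \<Omega> w q u \<longleftrightarrow>
     (\<forall>i\<le>q. \<forall>j\<le>q. weighted_inner \<Omega> w (u i) (u j) = (if i = j then 1 else 0)) \<and>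
     \<not> module.dependent smult (u ` {..q}) \<and>
     module.span smult (u ` {..q}) = polys_upto q"

end

theory Submission
  imports Defs
begin

text \<open>
  Since \<open>\<chi>\<close> is multiplication by \<open>x\<close> followed by a projection onto \<open>\<P>\<^sub>q\<close>, an eigenfunction
  satisfies \<open>\<langle>x p | u\<^sub>i\<rangle> = \<langle>p | x u\<^sub>i\<rangle> = \<Lambda>\<^sub>i \<langle>p | u\<^sub>i\<rangle>\<close> for \<open>p\<close> in \<open>\<P>\<^sub>q\<close>. Iterating,
  \<open>\<langle>p | u\<^sub>i\<rangle> = p(\<Lambda>\<^sub>i) \<langle>1 | u\<^sub>i\<rangle>\<close> for all \<open>p\<close> of degree at most \<open>q + 1\<close>, one degree more than the
  basis spans. By Parseval's identity the quadrature rule is then exact on every product \<open>a b\<close> with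
  \<open>a\<close> of degree at most \<open>q\<close> and \<open>b\<close> of degree at most \<open>q + 1\<close>, and these products span
  the polynomials of degree at most \<open>2 q + 1\<close>.
\<close>

lemma module_smult: "module (smult :: 'a::comm_ring_1 \<Rightarrow> 'a poly \<Rightarrow> 'a poly)"
  by unfold_locales (simp_all add: smult_add_left smult_add_right)

lemma weighted_inner_commute: "weighted_inner \<Omega> w a b = weighted_inner \<Omega> w b a"
  by (simp add: weighted_inner_def mult_ac)

text \<open>The integrand sees only the product of its polynomial factors. With
  \<open>c = [:0, 1:]\<close> this is the symmetry of multiplication by x.\<close>

lemma weighted_inner_shift_mult:
  "weighted_inner \<Omega> w (c * a) b = weighted_inner \<Omega> w a (c * b)"
  by (simp add: weighted_inner_def mult_ac)

lemma weighted_inner_one_mult: "weighted_inner \<Omega> w 1 (a * b) = weighted_inner \<Omega> w a b"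
  using weighted_inner_shift_mult[of \<Omega> w a 1 b] by simp

lemma weighted_inner_smult_left:
  "weighted_inner \<Omega> w (smult c a) b = c * weighted_inner \<Omega> w a b"
proof -
  have "weighted_inner \<Omega> w (smult c a) b
      = (LINT x|lebesgue_on \<Omega>. c * (w x * poly a x * poly b x))"
    unfolding weighted_inner_def by (simp add: mult_ac)
  then show ?thesis
    by (simp add: weighted_inner_def)
qed

lemma weighted_inner_smult_right:
  "weighted_inner \<Omega> w a (smult c b) = c * weighted_inner \<Omega> w a b"
  using weighted_inner_smult_left weighted_inner_commute by metis

lemma weighted_inner_zero_left [simp]: "weighted_inner \<Omega> w 0 b = 0"
  by (simp add: weighted_inner_def)

text \<open>Additivity of the inner product rests on this, since the integral splits over a sum only
  when the summands are integrable.\<close>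

lemma integrable_weight_poly:
  assumes "suitable_weight \<Omega> w"
  shows "integrable (lebesgue_on \<Omega>) (\<lambda>x. w x * poly p x)"
proof (rule Bochner_Integration.integrable_bound)
  show "integrable (lebesgue_on \<Omega>) (\<lambda>x. w x * \<bar>poly p x\<bar>)"
    using assms by (simp add: suitable_weight_def)
  have "\<Omega> \<in> sets lebesgue" "w \<in> borel_measurable (lebesgue_on \<Omega>)"
    using assms by (simp_all add: suitable_weight_def)
  moreover from this have "poly p \<in> borel_measurable (lebesgue_on \<Omega>)"
    by (intro continuous_imp_measurable_on_sets_lebesgue continuous_intros)
  ultimately show "(\<lambda>x. w x * poly p x) \<in> borel_measurable (lebesgue_on \<Omega>)"
    by simp
qed (simp add: abs_mult)

lemma weighted_inner_add_left:
  assumes "suitable_weight \<Omega> w"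
  shows "weighted_inner \<Omega> w (a + b) c = weighted_inner \<Omega> w a c + weighted_inner \<Omega> w b c"
proof -
  have "integrable (lebesgue_on \<Omega>) (\<lambda>x. w x * poly p x * poly c x)" for p
    using integrable_weight_poly[OF assms, of "p * c"] by (simp add: mult_ac)
  then show ?thesis
    by (simp add: weighted_inner_def distrib_left distrib_right)
qed

lemma weighted_inner_add_right:
  assumes "suitable_weight \<Omega> w"
  shows "weighted_inner \<Omega> w a (b + c) = weighted_inner \<Omega> w a b + weighted_inner \<Omega> w a c"
  using weighted_inner_add_left[OF assms] weighted_inner_commute by metis

lemma weighted_inner_diff_left:
  assumes "suitable_weight \<Omega> w"
  shows "weighted_inner \<Omega> w (a - b) c = weighted_inner \<Omega> w a c - weighted_inner \<Omega> w b c"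
  using weighted_inner_add_left[OF assms, of "a - b" b c] by simp

lemma weighted_inner_sum_left:
  assumes "suitable_weight \<Omega> w"
  shows "weighted_inner \<Omega> w (\<Sum>i\<in>A. g i) c = (\<Sum>i\<in>A. weighted_inner \<Omega> w (g i) c)"
  by (induction A rule: infinite_finite_induct) (simp_all add: weighted_inner_add_left[OF assms])

lemma weighted_inner_self_eq_0_iff:
  assumes "suitable_weight \<Omega> w"
  shows "weighted_inner \<Omega> w p p = 0 \<longleftrightarrow> p = 0"
proof -
  have "p \<noteq> 0 \<Longrightarrow> 0 < weighted_inner \<Omega> w p p"
    using assms by (simp add: suitable_weight_def weighted_inner_def power2_eq_square mult.assoc)
  then show ?thesis
    by fastforce
qed

lemma orthonormal_basis_upto_in_polys_upto:
  assumes "orthonormal_basis_upto \<Omega> w q u" "i \<le> q"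
  shows "u i \<in> polys_upto q"
  using assms module.span_base[OF module_smult, of "u i" "u ` {..q}"]
  by (auto simp: orthonormal_basis_upto_def)

text \<open>Both sides are linear in \<open>a\<close>, so induction over the span reduces the
  identity to a basis element, where orthonormality leaves one term. \<open>b\<close> ranges over
  all polynomials, so its degree may exceed \<open>q\<close>.\<close>

lemma weighted_inner_Parseval:
  assumes sw: "suitable_weight \<Omega> w" and ob: "orthonormal_basis_upto \<Omega> w q u"
    and a: "a \<in> polys_upto q"
  shows "weighted_inner \<Omega> w a b
    = (\<Sum>i\<le>q. weighted_inner \<Omega> w a (u i) * weighted_inner \<Omega> w b (u i))"
proof -
  have "a \<in> module.span smult (u ` {..q})"
    using ob a by (simp add: orthonormal_basis_upto_def)
  then show ?thesis
  proof (induction rule: module.span_induct_alt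
        [OF module_smult, consumes 1, case_names base step])
    case base
    then show ?case by simp
  next
    case (step c x y)
    then obtain j where j: "j \<le> q" "x = u j"
      by auto
    have "(\<Sum>i\<le>q. weighted_inner \<Omega> w x (u i) * weighted_inner \<Omega> w b (u i))
        = (\<Sum>i\<le>q. if i = j then weighted_inner \<Omega> w b (u i) else 0)"
      using ob j by (intro sum.cong) (auto simp: orthonormal_basis_upto_def)
    also have "\<dots> = weighted_inner \<Omega> w x b"
      using j by (simp add: weighted_inner_commute)
    finally show ?case
      using step by (simp add: weighted_inner_add_left[OF sw] weighted_inner_smult_left
          distrib_right sum.distrib sum_distrib_left[symmetric] mult.assoc)
  qed
qed

text \<open>The defining property of the projection becomes available once the description in
  \<open>proj_upto\<close> is known to have a unique solution.\<close>

lemma weighted_inner_proj_upto: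
  assumes sw: "suitable_weight \<Omega> w" and ob: "orthonormal_basis_upto \<Omega> w q u"
    and s: "s \<in> polys_upto q"
  shows "weighted_inner \<Omega> w (proj_upto \<Omega> w q p) s = weighted_inner \<Omega> w p s"
proof -
  define P where
    "P r \<longleftrightarrow> r \<in> polys_upto q \<and> (\<forall>s\<in>polys_upto q. weighted_inner \<Omega> w (p - r) s = 0)" for r
  \<comment> \<open>Existence: the Fourier expansion of \<open>p\<close> in the orthonormal
    basis.\<close>
  define r where "r = (\<Sum>i\<le>q. smult (weighted_inner \<Omega> w p (u i)) (u i))"
  have "degree r \<le> q"
    unfolding r_def
  proof (rule degree_sum_le)
    fix i assume "i \<in> {..q}"
    then have "degree (u i) \<le> q"
      using orthonormal_basis_upto_in_polys_upto[OF ob] by (simp add: polys_upto_def)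
    then show "degree (smult (weighted_inner \<Omega> w p (u i)) (u i)) \<le> q"
      by (meson degree_smult_le le_trans)
  qed simp
  moreover have "weighted_inner \<Omega> w r t = weighted_inner \<Omega> w p t" if "t \<in> polys_upto q" for t
    using weighted_inner_Parseval[OF sw ob that, of p]
    by (simp add: r_def weighted_inner_sum_left[OF sw] weighted_inner_smult_left
        weighted_inner_commute[of \<Omega> w t] mult.commute)
  ultimately have "P r"
    by (simp add: P_def polys_upto_def weighted_inner_diff_left[OF sw])
  moreover have "r' = r" if "P r'" for r'
  proof -
    \<comment> \<open>Uniqueness: the difference of two solutions lies in the space to which it is
      orthogonal, so its norm vanishes.\<close>
    have "r' - r \<in> polys_upto q"
      using that \<open>P r\<close> by (auto simp: P_def polys_upto_def intro: degree_diff_le)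
    then have "weighted_inner \<Omega> w (r' - r) (r' - r) = 0"
      using that \<open>P r\<close> by (simp add: P_def weighted_inner_diff_left[OF sw])
    then show ?thesis
      by (simp add: weighted_inner_self_eq_0_iff[OF sw])
  qed
  ultimately have "P (proj_upto \<Omega> w q p)"
    unfolding proj_upto_def P_def[symmetric] by (rule theI)
  then show ?thesis
    using s by (simp add: P_def weighted_inner_diff_left[OF sw])
qed

lemma weighted_inner_eigenfunction:
  assumes sw: "suitable_weight \<Omega> w" and ob: "orthonormal_basis_upto \<Omega> w q u"
    and eig: "position_op \<Omega> w q v = smult l v"
    and deg: "degree p \<le> q + 1"
  shows "weighted_inner \<Omega> w p v = poly p l * weighted_inner \<Omega> w 1 v"
  using deg
proof (induction p)
  case 0
  then show ?case by simp
next
  case (pCons a p)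
  \<comment> \<open>Horner's scheme: splitting off the constant term lowers the degree by one. The
    bound \<open>q + 1\<close> thus leaves a \<open>p\<close> that the projection can be tested
    against.\<close>
  then have p: "p \<in> polys_upto q"
    by (auto simp: polys_upto_def split: if_splits)
  have "weighted_inner \<Omega> w ([:0, 1:] * p) v = weighted_inner \<Omega> w ([:0, 1:] * v) p"
    using weighted_inner_shift_mult weighted_inner_commute by metis
  \<comment> \<open>Paired with \<open>p\<close>, the product x v may be replaced by its projection,
    which is \<open>smult l v\<close>.\<close>
  also have "\<dots> = weighted_inner \<Omega> w (smult l v) p"
    using weighted_inner_proj_upto[OF sw ob p] eig by (metis position_op_def)
  also have "\<dots> = l * (poly p l * weighted_inner \<Omega> w 1 v)"
    using pCons.IH p
    by (simp add: polys_upto_def weighted_inner_smult_left weighted_inner_commute[of \<Omega> w v])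
  finally have "weighted_inner \<Omega> w ([:0, 1:] * p) v = l * (poly p l * weighted_inner \<Omega> w 1 v)" .
  moreover have "pCons a p = smult a 1 + [:0, 1:] * p"
    by simp
  ultimately have "weighted_inner \<Omega> w (pCons a p) v
      = a * weighted_inner \<Omega> w 1 v + l * (poly p l * weighted_inner \<Omega> w 1 v)"
    by (simp only: weighted_inner_add_left[OF sw] weighted_inner_smult_left)
  then show ?case
    by (simp add: algebra_simps)
qed

theorem theorem7:
  fixes q :: nat
    and \<Omega> :: "real set"
    and \<I> :: "real set set"
    and w :: "real \<Rightarrow> real"
    and u :: "nat \<Rightarrow> real poly"
    and \<Lambda> :: "nat \<Rightarrow> real"
    and f :: "real poly"
  assumes "\<And>I. I \<in> \<I> \<Longrightarrow> is_interval I"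
    and "\<Omega> = \<Union>\<I>"
    and "suitable_weight \<Omega> w"
    and "orthonormal_basis_upto \<Omega> w q u"
    and "\<And>i. i \<le> q \<Longrightarrow> position_op \<Omega> w q (u i) = smult (\<Lambda> i) (u i)"
    and "degree f \<le> 2 * q + 1"
  shows "(LINT x|lebesgue_on \<Omega>. w x * poly f x) =
           (\<Sum>i = 0..q. (weighted_inner \<Omega> w 1 (u i))\<^sup>2 * poly f (\<Lambda> i))"
proof -
  note sw = assms(3) and ob = assms(4) and eig = assms(5)
  let ?I = "weighted_inner \<Omega> w"
  let ?Q = "\<lambda>g. \<Sum>i\<le>q. (?I 1 (u i))\<^sup>2 * poly g (\<Lambda> i)"
  have mon: "?I (monom 1 k) 1 = ?Q (monom 1 k)" if "k \<le> 2 * q + 1" for k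
  proof -
    \<comment> \<open>The first factor takes as much degree as Parseval's identity allows. At most
      \<open>q + 1\<close> remains for the second, and equality occurs at
      \<open>k = 2 * q + 1\<close>.\<close>
    define a b :: "real poly" where "a = monom 1 (min k q)" and "b = monom 1 (k - min k q)"
    have ab: "monom 1 k = a * b"
      by (simp add: a_def b_def mult_monom)
    have a: "degree a \<le> q" and b: "degree b \<le> q + 1"
      using that by (auto simp: a_def b_def degree_monom_eq)
    have "?I (monom 1 k) 1 = ?I a b"
      unfolding ab using weighted_inner_one_mult weighted_inner_commute by metis
    also have "\<dots> = (\<Sum>i\<le>q. ?I a (u i) * ?I b (u i))"
      using weighted_inner_Parseval[OF sw ob] a by (simp add: polys_upto_def)
    also have "\<dots> = ?Q (monom 1 k)"
      unfolding ab
    proof (rule sum.cong)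
      fix i assume "i \<in> {..q}"
      then have "position_op \<Omega> w q (u i) = smult (\<Lambda> i) (u i)"
        by (simp add: eig)
      note ev = weighted_inner_eigenfunction[OF sw ob this]
      have "?I a (u i) = poly a (\<Lambda> i) * ?I 1 (u i)"
        using a by (intro ev) simp
      moreover have "?I b (u i) = poly b (\<Lambda> i) * ?I 1 (u i)"
        using b by (rule ev)
      \<comment> \<open>Evaluation at a node is multiplicative, and the two factors
        \<open>?I 1 (u i)\<close> form the squared weight.\<close>
      ultimately show "?I a (u i) * ?I b (u i) = (?I 1 (u i))\<^sup>2 * poly (a * b) (\<Lambda> i)"
        by (simp add: power2_eq_square)
    qed simp
    finally show ?thesis .
  qed
  \<comment> \<open>Integral and quadrature sum are both linear in \<open>f\<close>, so exactness on
    monomials suffices.\<close>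
  have f: "f = (\<Sum>k\<le>degree f. smult (coeff f k) (monom 1 k))"
    using poly_as_sum_of_monoms[of f] by (simp add: smult_monom)
  have "(LINT x|lebesgue_on \<Omega>. w x * poly f x) = ?I f 1"
    by (simp add: weighted_inner_def)
  also have "\<dots> = (\<Sum>k\<le>degree f. coeff f k * ?I (monom 1 k) 1)"
    by (subst f) (simp only: weighted_inner_sum_left[OF sw] weighted_inner_smult_left)
  also have "\<dots> = (\<Sum>k\<le>degree f. coeff f k * ?Q (monom 1 k))"
    using mon assms(6) by (intro sum.cong) auto
  \<comment> \<open>With the node sum outermost, the monomials reassemble to the value of
    \<open>f\<close> at each node.\<close>
  also have "\<dots> = (\<Sum>i\<le>q. \<Sum>k\<le>degree f. coeff f k * ((?I 1 (u i))\<^sup>2 * poly (monom 1 k) (\<Lambda> i)))"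
    unfolding sum_distrib_left by (rule sum.swap)
  also have "\<dots> = ?Q f"
    by (simp add: poly_altdef[of f] poly_monom sum_distrib_left mult_ac)
  finally show ?thesis
    by (simp add: atLeast0AtMost)
qed

end
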